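(* Let $X$ be a separable Tychonoff space such that $\chi(X)<\mathfrak{p}$. Then $X$ is a strongly sequentially separable $s_{\mathbb{R}}$-space.
   Context: The character $\chi(X)$ is the least upper bound over $x\in X$ of the local characters $\chi(x,X)$, where $\chi(x,X)$ is the least cardinality of a local base at $x$. The cardinal $\mathfrak{p}$ is the least cardinality of a family $\mathcal{B}$ of subsets of $\omega$ which is a subbase for a free filter on $\omega$ (equivalently, every finite subfamily has infinite intersection) such that there is no infinite $A\subseteq\omega$ with $A\setminus B$ finite for all $B\in\mathcal{B}$. A space $X$ is strongly sequentially separable if $X$ is separable and each countable dense subset $D$ of $X$ is sequentially dense, i.e., every point of $X$ is the limit of a sequence of points of $D$. A function $f:X\to\mathbb{R}$ is $s$-continuous if its restriction to each convergent sequence in $X$ (together with its limit) is continuous. A space $X$ is an $s_{\mathbb{R}}$-space if every $s$-continuous function $f:X\to\mathbb{R}$ is continuous. *)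

theory Defs
  imports "HOL-Analysis.Analysis"
begin

unbundle cardinal_syntax

section \<open>Cardinal invariants\<close>

text \<open>
  Cardinals are represented, as in the library, by cardinal orders, which are determined only
  up to the isomorphism \<open>=o\<close>. The result of \<open>least_cardinal\<close> is a minimum with respect
  to \<open>\<le>o\<close>; by well-foundedness of \<open><o\<close> it exists for every nonempty set of cardinal orders.
\<close>

definition least_cardinal :: "'b rel set \<Rightarrow> 'b rel" where
  "least_cardinal R = (SOME r. r \<in> R \<and> (\<forall>s\<in>R. r \<le>o s))"

lemma least_cardinal:
  assumes "R \<noteq> {}" and "\<And>r. r \<in> R \<Longrightarrow> Card_order r"
  shows "least_cardinal R \<in> R" and "s \<in> R \<Longrightarrow> least_cardinal R \<le>o s"
proof -
  have "\<exists>r. r \<in> R \<and> (\<forall>s\<in>R. r \<le>o s)"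
    using exists_minim_Card_order[of R] assms by auto
  from someI_ex[OF this]
  show "least_cardinal R \<in> R" and "s \<in> R \<Longrightarrow> least_cardinal R \<le>o s"
    unfolding least_cardinal_def by auto
qed

definition local_base_at :: "'a topology \<Rightarrow> 'a \<Rightarrow> 'a set set \<Rightarrow> bool" where
  "local_base_at X x \<B> \<longleftrightarrow>
     (\<forall>B\<in>\<B>. openin X B \<and> x \<in> B) \<and>
     (\<forall>U. openin X U \<and> x \<in> U \<longrightarrow> (\<exists>B\<in>\<B>. B \<subseteq> U))"

definition local_character :: "'a topology \<Rightarrow> 'a \<Rightarrow> 'a set rel" where
  "local_character X x = least_cardinal {|\<B>| | \<B>. local_base_at X x \<B>}"

text \<open>
  The least upper bound of the local characters may be taken among the cardinal orders on
  \<open>'a set\<close>, since \<open>|UNIV :: 'a set set|\<close> is an upper bound.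
\<close>

definition character :: "'a topology \<Rightarrow> 'a set rel" where
  "character X =
     least_cardinal {r. Card_order r \<and> (\<forall>x\<in>topspace X. local_character X x \<le>o r)}"

definition strong_fip :: "nat set set \<Rightarrow> bool" where
  "strong_fip \<B> \<longleftrightarrow> (\<forall>\<C>. \<C> \<subseteq> \<B> \<and> finite \<C> \<longrightarrow> infinite (\<Inter>\<C>))"

definition pseudointersection :: "nat set \<Rightarrow> nat set set \<Rightarrow> bool" where
  "pseudointersection A \<B> \<longleftrightarrow> infinite A \<and> (\<forall>B\<in>\<B>. finite (A - B))"

definition cardinal_p :: "nat set rel" where
  "cardinal_p =
     least_cardinal {|\<B>| | \<B>. strong_fip \<B> \<and> \<not> (\<exists>A. pseudointersection A \<B>)}"

text \<open>
  \<open>strong_fip\<close> expresses generation of a free filter: adjoining the cofinite sets (which does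
  not affect pseudointersections), the family is a subbase of a proper filter. As all cofinite
  sets belong to a filter \<open>F\<close> on \<open>nat\<close> iff \<open>F \<le> cofinite\<close>, this reads as follows.
\<close>

lemma strong_fip_iff_free_filter:
  "strong_fip \<B> \<longleftrightarrow> (\<exists>F. F \<noteq> bot \<and> F \<le> cofinite \<and> (\<forall>B\<in>\<B>. eventually (\<lambda>n. n \<in> B) F))"
proof
  assume fip: "strong_fip \<B>"
  define F where "F = inf cofinite (INF B\<in>\<B>. principal B)"
  have "F \<noteq> bot"
  proof
    assume "F = bot"
    then have "eventually (\<lambda>_. False) F"
      by simp
    then obtain P Q where P: "eventually P cofinite" and Q: "eventually Q (INF B\<in>\<B>. principal B)"
      and PQ: "\<And>n. P n \<Longrightarrow> Q n \<Longrightarrow> False"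
      unfolding F_def eventually_inf by blast
    obtain \<C> where C: "\<C> \<subseteq> \<B>" "finite \<C>" "eventually Q (INF B\<in>\<C>. principal B)"
      using Q unfolding eventually_INF[of _ _ \<B>] by blast
    have "(INF B\<in>\<C>. principal B) = principal (\<Inter>\<C>)"
      using INF_principal_finite[OF C(2), of "\<lambda>B. B"] by simp
    then have "\<Inter>\<C> \<subseteq> {n. \<not> P n}"
      using C(3) PQ by (auto simp: eventually_principal)
    moreover have "finite {n. \<not> P n}"
      using P unfolding eventually_cofinite .
    moreover have "infinite (\<Inter>\<C>)"
      using fip C(1,2) unfolding strong_fip_def by blast
    ultimately show False
      using finite_subset by blast
  qed
  moreover have "eventually (\<lambda>n. n \<in> B) F" if "B \<in> \<B>" for B
  proof -
    have "F \<le> principal B"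
      unfolding F_def using that by (intro le_infI2 INF_lower)
    then show ?thesis
      by (simp add: le_principal)
  qed
  ultimately show "\<exists>F. F \<noteq> bot \<and> F \<le> cofinite \<and> (\<forall>B\<in>\<B>. eventually (\<lambda>n. n \<in> B) F)"
    using F_def by auto
next
  assume "\<exists>F. F \<noteq> bot \<and> F \<le> cofinite \<and> (\<forall>B\<in>\<B>. eventually (\<lambda>n. n \<in> B) F)"
  then obtain F where F: "F \<noteq> bot" "F \<le> cofinite" "\<forall>B\<in>\<B>. eventually (\<lambda>n. n \<in> B) F"
    by blast
  show "strong_fip \<B>"
    unfolding strong_fip_def
  proof (intro allI impI notI)
    fix \<C> assume C: "\<C> \<subseteq> \<B> \<and> finite \<C>" and fin: "finite (\<Inter>\<C>)"
    have "eventually (\<lambda>n. \<forall>B\<in>\<C>. n \<in> B) F"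
      using C F(3) by (intro eventually_ball_finite) auto
    moreover have "eventually (\<lambda>n. n \<notin> \<Inter>\<C>) F"
      using fin by (intro filter_leD[OF F(2)]) (simp only: eventually_cofinite not_not Collect_mem_eq)
    ultimately have "eventually (\<lambda>_. False) F"
      by eventually_elim auto
    then show False
      using F(1) by (simp add: eventually_False)
  qed
qed

lemma exists_strong_fip_no_pseudointersection:
  "\<exists>\<B>. strong_fip \<B> \<and> \<not> (\<exists>A. pseudointersection A \<B>)"
proof -
  define S :: "(nat \<Rightarrow> nat) \<Rightarrow> nat \<Rightarrow> nat set"
    where "S = (\<lambda>f k. prod_encode ` {(n, m). k \<le> n \<and> f n \<le> m})"
  define \<B> where "\<B> = {S f k | f k. True}"
  have "strong_fip \<B>"
    unfolding strong_fip_def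
  proof (intro allI impI)
    fix \<C> assume C: "\<C> \<subseteq> \<B> \<and> finite \<C>"
    then have "finite \<C>" "\<C> \<subseteq> \<B>" by auto
    then have "\<exists>f k. S f k \<subseteq> \<Inter>\<C>"
    proof (induction \<C> rule: finite_induct)
      case (insert B \<C>)
      then obtain f k where "S f k \<subseteq> \<Inter>\<C>"
        by auto
      moreover obtain g l where "B = S g l"
        using insert.prems unfolding \<B>_def by auto
      moreover have "S (\<lambda>n. max (f n) (g n)) (max k l) \<subseteq> S f k \<inter> S g l"
        unfolding S_def by auto
      ultimately have "S (\<lambda>n. max (f n) (g n)) (max k l) \<subseteq> \<Inter>(insert B \<C>)"
        by auto
      then show ?case by blast
    qed simp
    then obtain f k where fk: "S f k \<subseteq> \<Inter>\<C>" by blast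
    have "(\<lambda>j. prod_encode (k, f k + j)) ` UNIV \<subseteq> S f k"
      unfolding S_def by auto
    moreover have "infinite ((\<lambda>j. prod_encode (k, f k + j)) ` UNIV)"
      by (intro range_inj_infinite injI) (simp add: prod_encode_eq)
    ultimately show "infinite (\<Inter>\<C>)"
      using fk by (meson finite_subset)
  qed
  moreover have "\<not> pseudointersection A \<B>" for A
  proof
    assume A: "pseudointersection A \<B>"
    define A' where "A' = prod_decode ` A"
    have A_eq: "A = prod_encode ` A'"
      unfolding A'_def by (simp add: image_image)
    have fin: "finite (A' \<inter> {(n, m). n \<le> k})" for k
    proof -
      have "prod_encode ` (A' \<inter> {(n, m). n \<le> k}) \<subseteq> A - S (\<lambda>_. 0) (Suc k)"
        unfolding A_eq S_def by (auto simp: prod_encode_eq)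
      moreover have "finite (A - S (\<lambda>_. 0) (Suc k))"
        using A unfolding pseudointersection_def \<B>_def by auto
      ultimately show ?thesis
        by (rule finite_imageD[OF finite_subset]) (rule inj_prod_encode)
    qed
    define f where "f = (\<lambda>n. Suc (Max (insert 0 (snd ` (A' \<inter> {(i, m). i \<le> n})))))"
    have less: "m < f n" if "(n, m) \<in> A'" for n m
    proof -
      have "m \<le> Max (insert 0 (snd ` (A' \<inter> {(i, m). i \<le> n})))"
        using that fin by (intro Max_ge) force+
      then show ?thesis unfolding f_def by simp
    qed
    then have "A - S f 0 = A"
      unfolding A_eq S_def by (force simp: prod_encode_eq)
    moreover have "finite (A - S f 0)"
      using A unfolding pseudointersection_def \<B>_def by auto
    ultimately show False
      using A unfolding pseudointersection_def by simp
  qed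
  ultimately show ?thesis by blast
qed

lemma local_base_at_openin:
  "local_base_at X x {U. openin X U \<and> x \<in> U}"
  unfolding local_base_at_def by auto

lemma local_character_cases:
  obtains \<B> where "local_base_at X x \<B>" "local_character X x = |\<B>|"
    "\<And>\<B>'. local_base_at X x \<B>' \<Longrightarrow> |\<B>| \<le>o |\<B>'|"
proof -
  let ?R = "{|\<B>| | \<B>. local_base_at X x \<B>}"
  have ne: "?R \<noteq> {}" and co: "\<And>r. r \<in> ?R \<Longrightarrow> Card_order r"
    using local_base_at_openin[of X x] by (auto simp: card_of_Card_order)
  obtain \<B> where B: "local_base_at X x \<B>" "local_character X x = |\<B>|"
    using least_cardinal(1)[OF ne co] unfolding local_character_def[symmetric] by blast
  show ?thesis
  proof (rule that[OF B])
    fix \<B>' assume "local_base_at X x \<B>'"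
    then have "|\<B>'| \<in> ?R" by blast
    from least_cardinal(2)[OF ne co this] show "|\<B>| \<le>o |\<B>'|"
      unfolding local_character_def[symmetric] B(2) .
  qed
qed

lemma character_lub:
  fixes X :: "'a topology" and r :: "'a set rel"
  shows "Card_order (character X)"
    and "x \<in> topspace X \<Longrightarrow> local_character X x \<le>o character X"
    and "\<lbrakk>Card_order r; \<And>x. x \<in> topspace X \<Longrightarrow> local_character X x \<le>o r\<rbrakk> \<Longrightarrow> character X \<le>o r"
proof -
  define R where "R = {r :: 'a set rel. Card_order r \<and> (\<forall>x\<in>topspace X. local_character X x \<le>o r)}"
  have "local_character X x \<le>o |UNIV :: 'a set set|" for x
    by (rule local_character_cases[of X x]) (simp add: card_of_mono1)
  then have "|UNIV :: 'a set set| \<in> R"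
    unfolding R_def by (simp add: card_of_Card_order)
  then have ne: "R \<noteq> {}"
    by blast
  have co: "\<And>r. r \<in> R \<Longrightarrow> Card_order r"
    unfolding R_def by blast
  have char: "character X = least_cardinal R"
    unfolding character_def R_def ..
  have mem: "character X \<in> R"
    unfolding char by (rule least_cardinal(1)[OF ne co])
  show "Card_order (character X)"
    using mem by (rule co)
  show "local_character X x \<le>o character X" if "x \<in> topspace X"
    using mem that unfolding R_def by blast
  show "character X \<le>o r"
    if "Card_order r" "\<And>x. x \<in> topspace X \<Longrightarrow> local_character X x \<le>o r"
    unfolding char using that by (intro least_cardinal(2)[OF ne co]) (auto simp: R_def)
qed

lemma cardinal_p_cases:
  obtains \<B> where "strong_fip \<B>" "\<not> (\<exists>A. pseudointersection A \<B>)" "cardinal_p = |\<B>|"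
    "\<And>\<B>'. \<lbrakk>strong_fip \<B>'; \<not> (\<exists>A. pseudointersection A \<B>')\<rbrakk> \<Longrightarrow> |\<B>| \<le>o |\<B>'|"
proof -
  let ?R = "{|\<B>| | \<B>. strong_fip \<B> \<and> \<not> (\<exists>A. pseudointersection A \<B>)}"
  have ne: "?R \<noteq> {}" and co: "\<And>r. r \<in> ?R \<Longrightarrow> Card_order r"
    using exists_strong_fip_no_pseudointersection by (auto simp: card_of_Card_order)
  obtain \<B> where B: "strong_fip \<B>" "\<not> (\<exists>A. pseudointersection A \<B>)" "cardinal_p = |\<B>|"
    using least_cardinal(1)[OF ne co] unfolding cardinal_p_def[symmetric] by blast
  show ?thesis
  proof (rule that[OF B])
    fix \<B>' assume "strong_fip \<B>'" "\<not> (\<exists>A. pseudointersection A \<B>')"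
    then have "|\<B>'| \<in> ?R" by blast
    from least_cardinal(2)[OF ne co this] show "|\<B>| \<le>o |\<B>'|"
      unfolding cardinal_p_def[symmetric] B(3) .
  qed
qed


section \<open>Topological notions\<close>

definition tychonoff_space :: "'a topology \<Rightarrow> bool" where
  "tychonoff_space X \<longleftrightarrow> completely_regular_space X \<and> Hausdorff_space X"

definition dense_in :: "'a topology \<Rightarrow> 'a set \<Rightarrow> bool" where
  "dense_in X D \<longleftrightarrow> D \<subseteq> topspace X \<and> X closure_of D = topspace X"

definition sequentially_dense_in :: "'a topology \<Rightarrow> 'a set \<Rightarrow> bool" where
  "sequentially_dense_in X D \<longleftrightarrow> D \<subseteq> topspace X \<and>
     (\<forall>x\<in>topspace X. \<exists>s. range s \<subseteq> D \<and> limitin X s x sequentially)"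

definition strongly_sequentially_separable_space :: "'a topology \<Rightarrow> bool" where
  "strongly_sequentially_separable_space X \<longleftrightarrow> separable_space X \<and>
     (\<forall>D. countable D \<and> dense_in X D \<longrightarrow> sequentially_dense_in X D)"

definition s_continuous :: "'a topology \<Rightarrow> ('a \<Rightarrow> real) \<Rightarrow> bool" where
  "s_continuous X f \<longleftrightarrow>
     (\<forall>s x. range s \<subseteq> topspace X \<and> limitin X s x sequentially \<longrightarrow>
        continuous_map (subtopology X (insert x (range s))) euclideanreal f)"

definition s_real_space :: "'a topology \<Rightarrow> bool" where
  "s_real_space X \<longleftrightarrow> (\<forall>f. s_continuous X f \<longrightarrow> continuous_map X euclideanreal f)"

end

theory Submission
  imports Defs
begin

text \<open>
  If \<open>x\<close> lies in the closure of a countable set \<open>D\<close> but not in \<open>D\<close>, the traces on \<open>D\<close> of a local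
  base at \<open>x\<close> of size less than \<open>\<pp>\<close> have the strong finite intersection property, and a
  pseudointersection of them is a sequence in \<open>D\<close> converging to \<open>x\<close>. This gives strong sequential
  separability at once. If an s-continuous \<open>f\<close> oscillates by \<open>\<epsilon>\<close> at \<open>x\<close>, then, by moving the
  witnesses along sequences from a countable dense set \<open>D\<close>, already the points \<open>d \<in> D\<close> with
  \<open>\<bar>f d - f x\<bar> > \<epsilon>/2\<close> accumulate at \<open>x\<close>; a sequence of such points converging to \<open>x\<close>
  contradicts s-continuity.
\<close>

text \<open>By minimality of \<open>cardinal_p\<close>, a strong-fip family without a
  pseudointersection would have size at least \<open>cardinal_p\<close>.\<close>

lemma pseudointersection_below_cardinal_p:
  assumes "strong_fip \<B>" "|\<B>| <o cardinal_p"
  obtains A where "pseudointersection A \<B>"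
proof (rule cardinal_p_cases)
  fix \<P> assume p: "cardinal_p = |\<P>|"
    and min: "\<And>\<B>'. \<lbrakk>strong_fip \<B>'; \<not> (\<exists>A. pseudointersection A \<B>')\<rbrakk> \<Longrightarrow> |\<P>| \<le>o |\<B>'|"
  have "\<not> |\<P>| \<le>o |\<B>|"
    using assms(2) unfolding p by (rule not_ordLess_ordLeq)
  then show thesis
    using min[OF assms(1)] that by blast
qed

lemma sequence_from_countable_closure:
  assumes T1: "t1_space X" and "local_character X x <o cardinal_p"
    and "countable D" and x: "x \<in> X closure_of D"
  obtains s where "range s \<subseteq> D" "limitin X s x sequentially"
proof (cases "x \<in> D")
  \<comment> \<open>A constant sequence settles this case; the trace argument below relies on
    \<open>x \<notin> D\<close>.\<close>
  case True
  moreover have "x \<in> topspace X"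
    using x by (simp add: in_closure_of)
  ultimately show thesis
    using that[of "\<lambda>_. x"] T1 by (simp add: limitin_const_iff)
next
  case False
  obtain \<B> where \<B>: "local_base_at X x \<B>" "local_character X x = |\<B>|"
    by (rule local_character_cases)
  have ne: "D \<noteq> {}"
    using x by auto
  define e where "e = from_nat_into D"
  have e: "range e = D"
    unfolding e_def by (rule range_from_nat_into[OF ne \<open>countable D\<close>])
  \<comment> \<open>Traces are recorded as sets of indices, since \<open>strong_fip\<close> concerns
    subsets of \<open>nat\<close>. The enumeration \<open>e\<close> may repeat points; this does no
    harm.\<close>
  define tr where "tr = (\<lambda>B. {n. e n \<in> B})"
  have inf: "infinite (tr U)" if U: "openin X U" "x \<in> U" for U
  proof
    assume "finite (tr U)"
    then have fin: "finite (e ` tr U \<inter> topspace X)"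
      by simp
    \<comment> \<open>If only finitely many indices hit \<open>U\<close>, deleting their points, a
      closed set by T1, leaves a neighbourhood of \<open>x\<close> that misses
      \<open>D\<close>.\<close>
    have "openin X (U - e ` tr U \<inter> topspace X)"
      using T1 fin by (intro openin_diff[OF U(1)]) (simp add: t1_space_closedin_finite)
    moreover have "x \<in> U - e ` tr U \<inter> topspace X"
      using U(2) False e by blast
    moreover have "\<forall>T. x \<in> T \<and> openin X T \<longrightarrow> (\<exists>d. d \<in> D \<and> d \<in> T)"
      using x by (simp add: in_closure_of)
    ultimately obtain d where d: "d \<in> D" "d \<in> U - e ` tr U \<inter> topspace X"
      by meson
    then obtain n where "d = e n"
      using e by blast
    with d show False
      using openin_subset[OF U(1)] unfolding tr_def by auto
  qed
  have "strong_fip (tr ` \<B>)"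
    unfolding strong_fip_def
  proof (intro allI impI)
    fix \<C> assume "\<C> \<subseteq> tr ` \<B> \<and> finite \<C>"
    then obtain \<C>' where C: "\<C>' \<subseteq> \<B>" "finite \<C>'" "\<C> = tr ` \<C>'"
      by (meson finite_subset_image)
    have "\<forall>B\<in>\<C>'. openin X B \<and> x \<in> B"
      using C(1) \<B>(1) unfolding local_base_at_def by blast
    \<comment> \<open>Intersecting with \<open>topspace X\<close> covers the empty subfamily, whose
      intersection is \<open>UNIV\<close>.\<close>
    then have "openin X (topspace X \<inter> \<Inter>\<C>')" "x \<in> topspace X \<inter> \<Inter>\<C>'"
      using x C(2) by (blast intro: openin_Int_Inter, simp add: in_closure_of)
    then have "infinite (tr (topspace X \<inter> \<Inter>\<C>'))"
      by (rule inf)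
    moreover have "tr (topspace X \<inter> \<Inter>\<C>') \<subseteq> \<Inter>\<C>"
      unfolding C(3) tr_def by auto
    ultimately show "infinite (\<Inter>\<C>)"
      by (metis finite_subset)
  qed
  moreover have "|tr ` \<B>| <o cardinal_p"
    using ordLeq_ordLess_trans[OF card_of_image] assms(2) unfolding \<B>(2) by blast
  ultimately obtain A where A: "pseudointersection A (tr ` \<B>)"
    by (rule pseudointersection_below_cardinal_p)
  then have "infinite A"
    unfolding pseudointersection_def by blast
  show thesis
  proof (rule that)
    show "range (e \<circ> enumerate A) \<subseteq> D"
      using e by auto
    show "limitin X (e \<circ> enumerate A) x sequentially"
      unfolding limitin_def
    proof (intro conjI allI impI)
      show "x \<in> topspace X"
        using x by (simp add: in_closure_of)
      fix U assume "openin X U \<and> x \<in> U"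
      then obtain B where B: "B \<in> \<B>" "B \<subseteq> U"
        using \<B>(1) unfolding local_base_at_def by blast
      have "finite (A - tr B)"
        using A B(1) unfolding pseudointersection_def by blast
      \<comment> \<open>\<open>enumerate A\<close> is injective, so the finitely many indices of
        \<open>A\<close> outside \<open>tr B\<close> occur at only finitely many positions;
        elsewhere the sequence lies in \<open>B\<close>.\<close>
      then have "finite (enumerate A -` (A - tr B))"
        using strict_mono_enumerate[OF \<open>infinite A\<close>] strict_mono_imp_inj_on
        by (intro finite_vimageI) blast+
      moreover have "{n. (e \<circ> enumerate A) n \<notin> U} \<subseteq> enumerate A -` (A - tr B)"
        using B(2) enumerate_in_set[OF \<open>infinite A\<close>] unfolding tr_def by auto
      ultimately show "\<forall>\<^sub>F n in sequentially. (e \<circ> enumerate A) n \<in> U"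
        unfolding cofinite_eq_sequentially[symmetric] eventually_cofinite
        by (rule rev_finite_subset)
    qed
  qed
qed

text \<open>The sequence also converges in the subspace formed by its range and its limit, where
  \<open>f\<close> is continuous.\<close>

lemma s_continuous_tendsto:
  assumes "s_continuous X f" "range s \<subseteq> topspace X" "limitin X s x sequentially"
  shows "(\<lambda>n. f (s n)) \<longlonglongrightarrow> f x"
proof -
  let ?Y = "subtopology X (insert x (range s))"
  have "continuous_map ?Y euclideanreal f"
    using assms unfolding s_continuous_def by blast
  moreover have "limitin ?Y s x sequentially"
    using assms(3) by (simp add: limitin_subtopology)
  ultimately have "limitin euclideanreal (f \<circ> s) (f x) sequentially"
    by (rule continuous_map_limit)
  then show ?thesis
    by (simp add: o_def)
qed

theorem theorem8p2:
  fixes X :: "'a topology"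
  assumes "separable_space X"
    and "tychonoff_space X"
    and "character X <o cardinal_p"
  shows "strongly_sequentially_separable_space X \<and> s_real_space X"
proof -
  have T1: "t1_space X"
    using assms(2) by (simp add: tychonoff_space_def Hausdorff_imp_t1_space)
  have seq: "\<exists>s. range s \<subseteq> D \<and> limitin X s x sequentially"
    if "countable D" "x \<in> X closure_of D" for D x
  proof -
    have "x \<in> topspace X"
      using that(2) by (simp add: in_closure_of)
    then have "local_character X x <o cardinal_p"
      by (intro ordLeq_ordLess_trans[OF character_lub(2) assms(3)])
    from sequence_from_countable_closure[OF T1 this that] show ?thesis
      by blast
  qed
  have "strongly_sequentially_separable_space X"
    unfolding strongly_sequentially_separable_space_def sequentially_dense_in_def dense_in_def
    using assms(1) seq by auto
  moreover have "continuous_map X euclideanreal f" if f: "s_continuous X f" for f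
  proof -
    obtain D where D: "countable D" "D \<subseteq> topspace X" "X closure_of D = topspace X"
      using assms(1) unfolding separable_space_def by blast
    have "\<exists>U. openin X U \<and> x \<in> U \<and> (\<forall>y\<in>U. dist (f y) (f x) < \<epsilon>)"
      if x: "x \<in> topspace X" and "\<epsilon> > 0" for x \<epsilon>
    proof (rule ccontr)
      assume no_nbhd: "\<nexists>U. openin X U \<and> x \<in> U \<and> (\<forall>y\<in>U. dist (f y) (f x) < \<epsilon>)"
      \<comment> \<open>Halving \<epsilon> leaves room for a limit: a value at distance at least
        \<epsilon> from \<open>f x\<close> is approximated by values at distance above \<epsilon>/2,
        and these still cannot tend to \<open>f x\<close>.\<close>
      define E where "E = {d \<in> D. dist (f d) (f x) > \<epsilon> / 2}"
      have "\<exists>d\<in>E. d \<in> U" if U: "openin X U" "x \<in> U" for U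
      proof -
        obtain y where y: "y \<in> U" "\<not> dist (f y) (f x) < \<epsilon>"
          using no_nbhd U by blast
        then have "y \<in> X closure_of D"
          using D(3) openin_subset[OF U(1)] by blast
        from seq[OF D(1) this] obtain s
          where s: "range s \<subseteq> D" "limitin X s y sequentially"
          by blast
        have "(\<lambda>n. dist (f (s n)) (f x)) \<longlonglongrightarrow> dist (f y) (f x)"
          using s D(2) f by (intro tendsto_dist tendsto_const s_continuous_tendsto) auto
        then have "\<forall>\<^sub>F n in sequentially. dist (f (s n)) (f x) > \<epsilon> / 2"
          by (rule order_tendstoD) (use y(2) \<open>\<epsilon> > 0\<close> in linarith)
        moreover have "\<forall>\<^sub>F n in sequentially. s n \<in> U"
          using s(2) U(1) y(1) by (simp add: limitin_def)
        ultimately have "\<forall>\<^sub>F n in sequentially. dist (f (s n)) (f x) > \<epsilon> / 2 \<and> s n \<in> U"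
          by (rule eventually_conj)
        then obtain n where "dist (f (s n)) (f x) > \<epsilon> / 2" "s n \<in> U"
          using eventually_happens'[OF sequentially_bot] by blast
        then show ?thesis
          using s(1) unfolding E_def by blast
      qed
      then have "x \<in> X closure_of E"
        using x unfolding in_closure_of by blast
      moreover have "countable E"
        using D(1) unfolding E_def by simp
      ultimately obtain s where s: "range s \<subseteq> E" "limitin X s x sequentially"
        using seq by blast
      have "(\<lambda>n. f (s n)) \<longlonglongrightarrow> f x"
        using s D(2) by (intro s_continuous_tendsto[OF f]) (auto simp: E_def)
      then have "\<forall>\<^sub>F n in sequentially. dist (f (s n)) (f x) < \<epsilon> / 2"
        using \<open>\<epsilon> > 0\<close> by (intro tendstoD) auto
      then obtain n where "dist (f (s n)) (f x) < \<epsilon> / 2"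
        using eventually_happens'[OF sequentially_bot] by blast
      moreover have "s n \<in> E"
        using s(1) by blast
      ultimately show False
        by (simp add: E_def)
    qed
    \<comment> \<open>The neighbourhoods just found give the metric criterion for continuity, up to
      symmetry of \<open>dist\<close>.\<close>
    then show ?thesis
      using Met_TC.continuous_map_to_metric[of X f] by (simp add: dist_commute)
  qed
  ultimately show ?thesis
    unfolding s_real_space_def by blast
qed

end
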